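(* Let $0\le\epsilon$, $0\le\delta\le1$, let $D_{\mathcal X^n}$ be a probability distribution on $\mathcal X^n$, and let $q$ be a query. If a mechanism $M:\mathcal X^n\times\mathcal Q\to\mathcal R$ has $\delta$-approximate max-information of $\epsilon$ with respect to $D_{\mathcal X^n}$ and $q$, then it satisfies $(\epsilon,\delta)$-Local-Max-Information (LMI) with respect to the same $D_{\mathcal X^n}$ and $q$.
   Context: $\mathcal X$, $\mathcal Q$, $\mathcal R$ are countable sets and $n\in\mathbb N$. A mechanism is a possibly randomized function $M:\mathcal X^n\times\mathcal Q\to\mathcal R$; for fixed $q$ write $D(r\mid s)=\Pr[M(s,q)=r]$. Induced distributions: $D(s)=D_{\mathcal X^n}(s)$, $D(r)=\sum_sD(s)D(r\mid s)$, $D(x\mid s)=\frac1n|\{i:s_i=x\}|$, $D(x)=\sum_sD(s)D(x\mid s)$. On $\mathcal X^n\times\mathcal R$: joint $D_{(\mathcal X^n,\mathcal R)}(s,r)=D(s)D(r\mid s)$ and product $D_{\mathcal X^n\otimes\mathcal R}(s,r)=D(s)D(r)$. On $\mathcal X\times\mathcal R$: joint $D_{(\mathcal X,\mathcal R)}(x,r)=\sum_sD(s)D(x\mid s)D(r\mid s)$ and product $D_{\mathcal X\otimes\mathcal R}(x,r)=D(x)D(r)$. Two distributions $D_1,D_2$ on a set are $(\epsilon,\delta)$-indistinguishable if for every subset $\mathbf b$, $D_1(\mathbf b)\le e^\epsilon D_2(\mathbf b)+\delta$ and $D_2(\mathbf b)\le e^\epsilon D_1(\mathbf b)+\delta$.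 $M$ has $\delta$-approximate max-information of $\epsilon$ with respect to $D_{\mathcal X^n},q$ if $D_{(\mathcal X^n,\mathcal R)}$ and $D_{\mathcal X^n\otimes\mathcal R}$ are $(\epsilon,\delta)$-indistinguishable. $M$ satisfies $(\epsilon,\delta)$-LMI with respect to $D_{\mathcal X^n},q$ if $D_{(\mathcal X,\mathcal R)}$ and $D_{\mathcal X\otimes\mathcal R}$ are $(\epsilon,\delta)$-indistinguishable. *)

theory Defs
  imports "HOL-Probability.Probability"
begin

text \<open>
  Elements of \<open>X\<^sup>n\<close> are vectors of type \<^typ>\<open>'x ^ 'n\<close>, so \<open>n\<close> is \<open>CARD('n) \<ge> 1\<close>.
  A mechanism maps a sample and a query to a probability distribution on responses:
  \<open>D(r | s) = pmf (M (s, q)) r\<close>.  The lemmas ending in \<open>_eq\<close> give the pointwise formulas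
  of the induced distributions.
\<close>

type_synonym ('x, 'n, 'q, 'r) mechanism = "('x ^ 'n) \<times> 'q \<Rightarrow> 'r pmf"

definition response_dist :: "('x, 'n::finite, 'q, 'r) mechanism \<Rightarrow> ('x ^ 'n) pmf \<Rightarrow> 'q \<Rightarrow> 'r pmf"
  where "response_dist M DS q = bind_pmf DS (\<lambda>s. M (s, q))"

text \<open>The empirical distribution \<open>D(x | s)\<close>: the entry of \<open>s\<close> at a uniformly random index.\<close>

definition empirical_dist :: "'x ^ 'n::finite \<Rightarrow> 'x pmf"
  where "empirical_dist s = map_pmf (\<lambda>i. s $ i) (pmf_of_set UNIV)"

definition element_dist :: "('x ^ 'n::finite) pmf \<Rightarrow> 'x pmf"
  where "element_dist DS = bind_pmf DS empirical_dist"

definition sample_response_joint ::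
    "('x, 'n::finite, 'q, 'r) mechanism \<Rightarrow> ('x ^ 'n) pmf \<Rightarrow> 'q \<Rightarrow> (('x ^ 'n) \<times> 'r) pmf"
  where "sample_response_joint M DS q = bind_pmf DS (\<lambda>s. map_pmf (\<lambda>r. (s, r)) (M (s, q)))"

definition sample_response_product ::
    "('x, 'n::finite, 'q, 'r) mechanism \<Rightarrow> ('x ^ 'n) pmf \<Rightarrow> 'q \<Rightarrow> (('x ^ 'n) \<times> 'r) pmf"
  where "sample_response_product M DS q = pair_pmf DS (response_dist M DS q)"

definition element_response_joint ::
    "('x, 'n::finite, 'q, 'r) mechanism \<Rightarrow> ('x ^ 'n) pmf \<Rightarrow> 'q \<Rightarrow> ('x \<times> 'r) pmf"
  where "element_response_joint M DS q =
    bind_pmf DS (\<lambda>s. pair_pmf (empirical_dist s) (M (s, q)))"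

definition element_response_product ::
    "('x, 'n::finite, 'q, 'r) mechanism \<Rightarrow> ('x ^ 'n) pmf \<Rightarrow> 'q \<Rightarrow> ('x \<times> 'r) pmf"
  where "element_response_product M DS q = pair_pmf (element_dist DS) (response_dist M DS q)"

definition indistinguishable :: "real \<Rightarrow> real \<Rightarrow> 'a pmf \<Rightarrow> 'a pmf \<Rightarrow> bool"
  where "indistinguishable \<epsilon> \<delta> D1 D2 \<longleftrightarrow>
    (\<forall>b. measure_pmf.prob D1 b \<le> exp \<epsilon> * measure_pmf.prob D2 b + \<delta> \<and>
         measure_pmf.prob D2 b \<le> exp \<epsilon> * measure_pmf.prob D1 b + \<delta>)"

text \<open>\<open>M\<close> has \<open>\<delta>\<close>-approximate max-information of \<open>\<epsilon>\<close> w.r.t. \<open>DS\<close> and \<open>q\<close>.\<close>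

definition approx_max_information ::
    "real \<Rightarrow> real \<Rightarrow> ('x, 'n::finite, 'q, 'r) mechanism \<Rightarrow> ('x ^ 'n) pmf \<Rightarrow> 'q \<Rightarrow> bool"
  where "approx_max_information \<delta> \<epsilon> M DS q \<longleftrightarrow>
    indistinguishable \<epsilon> \<delta> (sample_response_joint M DS q) (sample_response_product M DS q)"

definition local_max_information ::
    "real \<Rightarrow> real \<Rightarrow> ('x, 'n::finite, 'q, 'r) mechanism \<Rightarrow> ('x ^ 'n) pmf \<Rightarrow> 'q \<Rightarrow> bool"
  where "local_max_information \<epsilon> \<delta> M DS q \<longleftrightarrow>
    indistinguishable \<epsilon> \<delta> (element_response_joint M DS q) (element_response_product M DS q)"

lemma pmf_bind_infsum: "pmf (bind_pmf p f) y = (\<Sum>\<^sub>\<infinity>s. pmf p s * pmf (f s) y)"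
proof -
  have "Infinite_Set_Sum.abs_summable_on (\<lambda>s. pmf p s * pmf (f s) y) UNIV"
  proof (rule abs_summable_on_comparison_test'[where g = "pmf p"])
    show "Infinite_Set_Sum.abs_summable_on (pmf p) UNIV"
      by (rule pmf_abs_summable)
    show "norm (pmf p s * pmf (f s) y) \<le> pmf p s" for s
      by (simp add: mult_left_le pmf_le_1)
  qed
  then show ?thesis
    by (simp add: pmf_bind pmf_expectation_eq_infsetsum infsetsum_infsum)
qed

lemma response_dist_eq:
  "pmf (response_dist M DS q) r = (\<Sum>\<^sub>\<infinity>s. pmf DS s * pmf (M (s, q)) r)"
  by (simp add: response_dist_def pmf_bind_infsum)

lemma empirical_dist_eq:
  fixes s :: "'x ^ 'n::finite"
  shows "pmf (empirical_dist s) x = 1 / real CARD('n) * real (card {i. s $ i = x})"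
  by (simp add: empirical_dist_def pmf_map measure_pmf_of_set vimage_def)

lemma element_dist_eq:
  "pmf (element_dist DS) x = (\<Sum>\<^sub>\<infinity>s. pmf DS s * pmf (empirical_dist s) x)"
  by (simp add: element_dist_def pmf_bind_infsum)

lemma sample_response_joint_eq:
  "pmf (sample_response_joint M DS q) (s, r) = pmf DS s * pmf (M (s, q)) r"
proof -
  have "pmf (map_pmf (Pair s') (M (s', q))) (s, r) = indicator {s} s' * pmf (M (s', q)) r" for s'
  proof (cases "s' = s")
    case True
    then show ?thesis by (simp add: pmf_map_inj' inj_on_def)
  next
    case False
    then show ?thesis by (auto simp: pmf_eq_0_set_pmf)
  qed
  then have "pmf (sample_response_joint M DS q) (s, r) =
      (\<Sum>\<^sub>\<infinity>s'. pmf DS s' * (indicator {s} s' * pmf (M (s', q)) r))"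
    by (simp add: sample_response_joint_def pmf_bind_infsum)
  also have "\<dots> = (\<Sum>\<^sub>\<infinity>s'\<in>{s}. pmf DS s' * pmf (M (s', q)) r)"
    by (rule infsum_cong_neutral) auto
  finally show ?thesis by simp
qed

lemma sample_response_product_eq:
  "pmf (sample_response_product M DS q) (s, r) = pmf DS s * pmf (response_dist M DS q) r"
  by (simp add: sample_response_product_def pmf_pair)

lemma element_response_joint_eq:
  "pmf (element_response_joint M DS q) (x, r) =
    (\<Sum>\<^sub>\<infinity>s. pmf DS s * pmf (empirical_dist s) x * pmf (M (s, q)) r)"
  by (simp add: element_response_joint_def pmf_bind_infsum pmf_pair mult.assoc)

lemma element_response_product_eq:
  "pmf (element_response_product M DS q) (x, r) =
    pmf (element_dist DS) x * pmf (response_dist M DS q) r"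
  by (simp add: element_response_product_def pmf_pair)

end

theory Submission
  imports Defs
begin

text \<open>
  Drawing an index \<open>i\<close> uniformly and mapping \<open>(s, r)\<close> to \<open>(s\<^sub>i, r)\<close> turns the joint, respectively
  product, distribution on samples and responses into the one on elements and responses, and
  indistinguishability is preserved by maps and by mixtures.
\<close>

text \<open>An event \<open>b\<close> has the same probability under \<open>map_pmf f D\<close> as
  its preimage under \<open>f\<close> has under \<open>D\<close>, and the hypothesis covers every
  event.\<close>

lemma indistinguishable_map_pmf:
  assumes "indistinguishable \<epsilon> \<delta> D1 D2"
  shows "indistinguishable \<epsilon> \<delta> (map_pmf f D1) (map_pmf f D2)"
  using assms by (simp add: indistinguishable_def)

lemma prob_bind_pmf:
  "measure_pmf.prob (bind_pmf p f) b = measure_pmf.expectation p (\<lambda>i. measure_pmf.prob (f i) b)"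
  unfolding measure_pmf_bind
  by (subst measure_pmf.measure_bind[where N = "count_space UNIV"])
     (auto intro!: prob_space_imp_subprob_space simp: space_subprob_algebra measure_pmf.subprob_space_axioms)

text \<open>For a fixed event both inequalities are affine in the probabilities, so they survive
  averaging over \<open>p\<close>; the constant \<delta> averages to itself since \<open>p\<close>
  has total mass 1.\<close>

lemma indistinguishable_bind_pmf:
  assumes "\<And>i. indistinguishable \<epsilon> \<delta> (D1 i) (D2 i)"
  shows "indistinguishable \<epsilon> \<delta> (bind_pmf p D1) (bind_pmf p D2)"
proof -
  have integrable: "integrable (measure_pmf p) (\<lambda>i. measure_pmf.prob (D i) b)" for D :: "_ \<Rightarrow> _ pmf" and b
    by (rule measure_pmf.integrable_const_bound[where B = 1]) auto
  \<comment> \<open>Stated for arbitrary families so that it serves both directions, with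
    \<open>D1\<close> and \<open>D2\<close> swapped.\<close>
  have "measure_pmf.prob (bind_pmf p D) b \<le> exp \<epsilon> * measure_pmf.prob (bind_pmf p D') b + \<delta>"
    if "\<And>i. measure_pmf.prob (D i) b \<le> exp \<epsilon> * measure_pmf.prob (D' i) b + \<delta>"
    for D D' :: "_ \<Rightarrow> _ pmf" and b
  proof -
    have "measure_pmf.prob (bind_pmf p D) b
        \<le> measure_pmf.expectation p (\<lambda>i. exp \<epsilon> * measure_pmf.prob (D' i) b + \<delta>)"
      unfolding prob_bind_pmf by (intro integral_mono that) (simp_all add: integrable)
    then show ?thesis
      by (simp add: prob_bind_pmf integrable)
  qed
  with assms show ?thesis
    unfolding indistinguishable_def by blast
qed

lemma element_response_joint_conv_mixture:
  "element_response_joint M DS q =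
    bind_pmf (pmf_of_set UNIV)
      (\<lambda>i. map_pmf (map_prod (\<lambda>s. s $ i) id) (sample_response_joint M DS q))"
proof -
  have "element_response_joint M DS q =
      bind_pmf DS (\<lambda>s. bind_pmf (pmf_of_set UNIV) (\<lambda>i. map_pmf (Pair (s $ i)) (M (s, q))))"
    by (simp add: element_response_joint_def empirical_dist_def pair_pmf_def map_pmf_def
        bind_assoc_pmf bind_return_pmf)
  \<comment> \<open>The law of the index is the same for every \<open>s\<close>, so index and sample
    can be drawn in either order.\<close>
  also have "\<dots> =
      bind_pmf (pmf_of_set UNIV) (\<lambda>i. bind_pmf DS (\<lambda>s. map_pmf (Pair (s $ i)) (M (s, q))))"
    by (rule bind_commute_pmf)
  finally show ?thesis
    by (simp add: sample_response_joint_def map_bind_pmf pmf.map_comp o_def)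
qed

text \<open>Only the element component depends on the index: once \<open>element_dist\<close> is a
  mixture over \<open>i\<close>, associativity of \<open>bind_pmf\<close> moves the independent
  response draw inside it.\<close>

lemma element_response_product_conv_mixture:
  "element_response_product M DS q =
    bind_pmf (pmf_of_set UNIV)
      (\<lambda>i. map_pmf (map_prod (\<lambda>s. s $ i) id) (sample_response_product M DS q))"
proof -
  have "element_dist DS = bind_pmf (pmf_of_set UNIV) (\<lambda>i. map_pmf (\<lambda>s. s $ i) DS)"
    unfolding element_dist_def empirical_dist_def map_pmf_def by (rule bind_commute_pmf)
  then show ?thesis
    by (simp add: element_response_product_def sample_response_product_def pair_pmf_def
        map_pmf_def bind_assoc_pmf bind_return_pmf)
qed

theorem theorem4p9:
  fixes M :: "('x::countable, 'n::finite, 'q::countable, 'r::countable) mechanism"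
    and DS :: "('x ^ 'n) pmf"
    and q :: 'q
    and \<epsilon> \<delta> :: real
  assumes "0 \<le> \<epsilon>"
    and "0 \<le> \<delta>" and "\<delta> \<le> 1"
    and "approx_max_information \<delta> \<epsilon> M DS q"
  shows "local_max_information \<epsilon> \<delta> M DS q"
  using assms(4)
  unfolding approx_max_information_def local_max_information_def
    element_response_joint_conv_mixture element_response_product_conv_mixture
  by (intro indistinguishable_bind_pmf indistinguishable_map_pmf)

end
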